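(* Let $\alpha, k \geq 1$ be integers and $n = 2\alpha(\alpha+4)k + 2\alpha + 5$. The subset \[ S = \{ \pm(2\alpha\ell + 1) : 0 \leq \ell \leq k \} \subset \mathbb{Z}_n \] satisfies $\mathcal{R}_{2\alpha+2}(S) = \mathbb{Z}_n \setminus (S \cup \{0\})$ and $0 \notin (2\alpha+3)S$.
   Context: $\mathbb{Z}_n$ is the cyclic group of integers modulo $n$. For $S \subseteq \mathbb{Z}_n$ and an integer $m \geq 1$, $mS = \{s_1 + \dots + s_m : s_i \in S\}$. For an integer $m\ge 1$, $\mathcal{R}_m(S) = \{ s_1 + \dots + s_m : s_i \in S \text{ and } s_i + s_{i+1} + \dots + s_j \neq 0 \text{ for all } 1 \leq i < j \leq m\}$, the set of $m$-fold sums admitting a representation in which no sum of consecutive terms $s_i+\dots+s_j$ ($i<j$) is $0$ in $\mathbb{Z}_n$. *)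

theory Defs
  imports "HOL-Algebra.Elementary_Groups" "HOL-Algebra.FiniteProduct"
begin

text \<open>
  Abelian groups are HOL-Algebra groups, hence written multiplicatively: the sums of the
  mathematical text are products \<^const>\<open>finprod\<close>, and its \<open>0\<close> is \<open>\<one>\<^bsub>G\<^esub>\<close>. The group
  $\mathbf{Z}_n$ is \<^const>\<open>integer_mod_group\<close>, whose elements are the residues in \<open>{0..<int n}\<close>
  (for \<open>n > 0\<close>) and whose unit is the integer \<open>0\<close>.
\<close>

definition sumset_fold :: "('a, 'b) monoid_scheme \<Rightarrow> nat \<Rightarrow> 'a set \<Rightarrow> 'a set" where
  "sumset_fold G m S = {finprod G s {1..m} |s. \<forall>i\<in>{1..m}. s i \<in> S}"

text \<open>
  The condition on consecutive terms is imposed for \<open>i < j\<close> only, so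
  single terms are not required to be nonzero.
\<close>

definition restricted_sums :: "('a, 'b) monoid_scheme \<Rightarrow> nat \<Rightarrow> 'a set \<Rightarrow> 'a set" where
  "restricted_sums G m S =
     {finprod G s {1..m} |s. (\<forall>i\<in>{1..m}. s i \<in> S) \<and>
        (\<forall>i j. 1 \<le> i \<and> i < j \<and> j \<le> m \<longrightarrow> finprod G s {i..j} \<noteq> \<one>\<^bsub>G\<^esub>)}"

definition pm_progression :: "nat \<Rightarrow> nat \<Rightarrow> nat \<Rightarrow> int set" where
  "pm_progression n \<alpha> k =
     {(2 * int \<alpha> * int l + 1) mod int n |l. l \<le> k} \<union>
     {(- (2 * int \<alpha> * int l + 1)) mod int n |l. l \<le> k}"

end

theory Submission
  imports Defs
begin

text \<open>
  A sum of $M \le 2\alpha+3$ terms $\pm(2\alpha\ell+1)$ is an integer $2\alpha L + E$ with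
  $|E| \le M$ and $(E-M)k \le 2L \le (E+M)k$. These bounds exclude every nonzero multiple of $n$,
  so such a sum vanishes in $\mathbf{Z}_n$ only if it vanishes as an integer. In particular an
  odd number of terms never sums to \<open>0\<close>, which gives both the second claim and, as $S = -S$, that
  $\mathcal{R}_{2\alpha+2}(S)$ is disjoint from $S$.

  Conversely, up to sign every nonzero residue is $2y$ with $0 < 2y < n$. Write $y = \alpha L + e$
  with $2 \le e \le \alpha+1$ (and $L = 0$, $e = 1$ for $y = 1$), and use $\alpha+1+e$ positive
  terms followed by $\alpha+1-e$ negative ones. If the last positive term is at least $2\alpha+1$ and all
  negative terms are $-1$, no sum of consecutive terms is \<open>0\<close>; for $L = 0$ one instead takes the first
  positive term $2\alpha+1$, the first negative one $-(2\alpha+1)$, and all others $\pm 1$.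
\<close>

section \<open>Integer representatives of the terms and of their sums\<close>

definition signed_progression :: "nat \<Rightarrow> nat \<Rightarrow> int set" where
  "signed_progression \<alpha> k =
     {2 * int \<alpha> * int l + 1 |l. l \<le> k} \<union> {- (2 * int \<alpha> * int l + 1) |l. l \<le> k}"

lemma pm_progression_eq_image:
  "pm_progression n \<alpha> k = (\<lambda>z. z mod int n) ` signed_progression \<alpha> k"
  unfolding pm_progression_def signed_progression_def by (auto simp: image_iff)

lemma pos_in_signed_progression: "l \<le> k \<Longrightarrow> 2 * int \<alpha> * int l + 1 \<in> signed_progression \<alpha> k"
  and neg_in_signed_progression: "l \<le> k \<Longrightarrow> - (2 * int \<alpha> * int l) - 1 \<in> signed_progression \<alpha> k"
  unfolding signed_progression_def by force+

lemma uminus_signed_progression: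
  "z \<in> signed_progression \<alpha> k \<Longrightarrow> - z \<in> signed_progression \<alpha> k"
  unfolding signed_progression_def by force

lemma odd_signed_progression: "z \<in> signed_progression \<alpha> k \<Longrightarrow> odd z"
  unfolding signed_progression_def by auto

lemma even_sum_signed_progression:
  assumes "finite A" "\<And>i. i \<in> A \<Longrightarrow> t i \<in> signed_progression \<alpha> k"
  shows "even (sum t A) \<longleftrightarrow> even (card A)"
  using assms by (induction A rule: finite_induct) (auto dest!: odd_signed_progression)

lemma finprod_integer_mod_group:
  assumes "n > 0" "finite A"
  shows "finprod (integer_mod_group n) (\<lambda>i. t i mod int n) A = sum t A mod int n"
proof -
  interpret comm_group "integer_mod_group n"
    by (rule abelian_integer_mod_group)
  have c: "(\<lambda>i. t i mod int n) \<in> B \<rightarrow> carrier (integer_mod_group n)" for B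
    using \<open>n > 0\<close> by (auto simp: carrier_integer_mod_group)
  from assms(2) show ?thesis
  proof (induction A rule: finite_induct)
    case empty
    then show ?case by (simp add: one_integer_mod_group)
  next
    case (insert a F)
    then show ?case
      using c[of F] \<open>n > 0\<close>
      by (simp add: finprod_insert carrier_integer_mod_group mult_integer_mod_group mod_simps)
  qed
qed

lemma choose_lift:
  assumes "\<forall>i\<in>A. s i \<in> f ` T"
  shows "\<exists>t. \<forall>i\<in>A. t i \<in> T \<and> s i = f (t i)"
  by (rule bchoice) (use assms in blast)

text \<open>Lifting each term to an integer changes no sum modulo \<open>n\<close>. Together with
  the counterpart for \<open>restricted_sums\<close>, this moves the problem to integer sums, where
  parity and size arguments apply.\<close>

lemma sumset_fold_integer_mod_group:
  assumes "n > 0"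
  shows "sumset_fold (integer_mod_group n) m ((\<lambda>z. z mod int n) ` T)
    = {sum t {1..m} mod int n |t. \<forall>i\<in>{1..m}. t i \<in> T}" (is "?L = ?R")
proof (intro equalityI subsetI)
  interpret comm_group "integer_mod_group n"
    by (rule abelian_integer_mod_group)
  fix x assume "x \<in> ?L"
  then obtain s where x: "x = finprod (integer_mod_group n) s {1..m}"
    and s: "\<forall>i\<in>{1..m}. s i \<in> (\<lambda>z. z mod int n) ` T"
    unfolding sumset_fold_def by blast
  obtain t where t: "\<And>i. i \<in> {1..m} \<Longrightarrow> t i \<in> T"
      "\<And>i. i \<in> {1..m} \<Longrightarrow> s i = t i mod int n"
    using choose_lift[OF s] by blast
  have "x = finprod (integer_mod_group n) (\<lambda>i. t i mod int n) {1..m}"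
    unfolding x using t(2) assms by (intro finprod_cong') (auto simp: carrier_integer_mod_group)
  then show "x \<in> ?R"
    using t(1) by (auto simp: finprod_integer_mod_group assms)
next
  fix x assume "x \<in> ?R"
  then obtain t where "x = sum t {1..m} mod int n" "\<forall>i\<in>{1..m}. t i \<in> T" by blast
  then show "x \<in> ?L"
    unfolding sumset_fold_def
    by (intro CollectI exI[of _ "\<lambda>i. t i mod int n"]) (auto simp: finprod_integer_mod_group assms)
qed

lemma restricted_sums_integer_mod_group:
  assumes "n > 0"
  shows "restricted_sums (integer_mod_group n) m ((\<lambda>z. z mod int n) ` T)
    = {sum t {1..m} mod int n |t. (\<forall>i\<in>{1..m}. t i \<in> T) \<and>
        (\<forall>i j. 1 \<le> i \<and> i < j \<and> j \<le> m \<longrightarrow> \<not> int n dvd sum t {i..j})}" (is "?L = ?R")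
proof (intro equalityI subsetI)
  interpret comm_group "integer_mod_group n"
    by (rule abelian_integer_mod_group)
  fix x assume "x \<in> ?L"
  then obtain s where x: "x = finprod (integer_mod_group n) s {1..m}"
    and s: "\<forall>i\<in>{1..m}. s i \<in> (\<lambda>z. z mod int n) ` T"
    and w: "\<And>i j. 1 \<le> i \<Longrightarrow> i < j \<Longrightarrow> j \<le> m \<Longrightarrow> finprod (integer_mod_group n) s {i..j} \<noteq> 0"
    unfolding restricted_sums_def by (auto simp: one_integer_mod_group)
  obtain t where t: "\<And>i. i \<in> {1..m} \<Longrightarrow> t i \<in> T"
      "\<And>i. i \<in> {1..m} \<Longrightarrow> s i = t i mod int n"
    using choose_lift[OF s] by blast
  \<comment> \<open>One lift \<open>t\<close> serves every block, so the value of \<open>x\<close>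
    and all the nonvanishing conditions are transferred at once.\<close>
  have eq: "finprod (integer_mod_group n) s {i..j} = sum t {i..j} mod int n"
    if "1 \<le> i" "j \<le> m" for i j
  proof -
    have "finprod (integer_mod_group n) s {i..j}
        = finprod (integer_mod_group n) (\<lambda>i. t i mod int n) {i..j}"
      using t(2) assms that by (intro finprod_cong') (auto simp: carrier_integer_mod_group)
    then show ?thesis by (simp add: finprod_integer_mod_group assms)
  qed
  then show "x \<in> ?R"
    using t(1) w unfolding x by (intro CollectI exI[of _ t]) (auto simp: dvd_eq_mod_eq_0)
next
  fix x assume "x \<in> ?R"
  then obtain t where "x = sum t {1..m} mod int n" "\<forall>i\<in>{1..m}. t i \<in> T"
    "\<forall>i j. 1 \<le> i \<and> i < j \<and> j \<le> m \<longrightarrow> \<not> int n dvd sum t {i..j}" by blast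
  then show "x \<in> ?L"
    unfolding restricted_sums_def
    by (intro CollectI exI[of _ "\<lambda>i. t i mod int n"])
      (auto simp: finprod_integer_mod_group assms one_integer_mod_group dvd_eq_mod_eq_0)
qed

section \<open>Which sums are divisible by \<open>n\<close>\<close>

text \<open>With P positive and N negative terms, E = P - N and \<open>card A\<close> = P + N, while
  L is the signed sum of the indices \<open>l\<close>. The last two bounds therefore say L \<le> P k
  and -N k \<le> L.\<close>

lemma sum_signed_progression:
  assumes "finite A" "\<And>i. i \<in> A \<Longrightarrow> t i \<in> signed_progression \<alpha> k"
  obtains L E :: int where "sum t A = 2 * int \<alpha> * L + E" "\<bar>E\<bar> \<le> int (card A)"
    "2 * L \<le> (E + int (card A)) * int k" "(E - int (card A)) * int k \<le> 2 * L"
proof -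
  have "\<exists>L E :: int. sum t A = 2 * int \<alpha> * L + E \<and> \<bar>E\<bar> \<le> int (card A) \<and>
    2 * L \<le> (E + int (card A)) * int k \<and> (E - int (card A)) * int k \<le> 2 * L"
    using assms
  proof (induction A rule: finite_induct)
    case (insert a F)
    then obtain L E :: int where IH: "sum t F = 2 * int \<alpha> * L + E" "\<bar>E\<bar> \<le> int (card F)"
      "2 * L \<le> (E + int (card F)) * int k" "(E - int (card F)) * int k \<le> 2 * L"
      by auto
    from insert.prems[of a] obtain l where l: "l \<le> k"
      and "t a = 2 * int \<alpha> * int l + 1 \<or> t a = - (2 * int \<alpha> * int l + 1)"
      unfolding signed_progression_def by auto
    from this(2) show ?case
    proof
      assume "t a = 2 * int \<alpha> * int l + 1"
      then show ?thesis
        using insert.hyps IH l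
        by (intro exI[of _ "L + int l"] exI[of _ "E + 1"]) (auto simp: algebra_simps)
    next
      assume "t a = - (2 * int \<alpha> * int l + 1)"
      then show ?thesis
        using insert.hyps IH l
        by (intro exI[of _ "L - int l"] exI[of _ "E - 1"]) (auto simp: algebra_simps)
    qed
  qed auto
  then show ?thesis using that by blast
qed

text \<open>Equality would force E = 5 + 2at, where t measures how far L falls short of (a+4)k + 1.
  If t \<ge> 1, then E exceeds M; if t \<le> 0, then L is too large for the bound in terms of E +
  M.\<close>

lemma progression_sum_neq_modulus:
  fixes a k L E M :: int
  assumes "a \<ge> 1" "k \<ge> 1" "E \<le> M" "M \<le> 2 * a + 3" "2 * L \<le> (E + M) * k"
  shows "2 * a * L + E \<noteq> 2 * a * (a + 4) * k + 2 * a + 5"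
proof
  assume eq: "2 * a * L + E = 2 * a * (a + 4) * k + 2 * a + 5"
  define t where "t = (a + 4) * k + 1 - L"
  have E: "E = 5 + 2 * a * t" using eq by (simp add: t_def algebra_simps)
  have "t \<le> 0"
  proof (rule ccontr)
    assume "\<not> t \<le> 0"
    then have "a * 1 \<le> a * t" using \<open>a \<ge> 1\<close> by (intro mult_left_mono) auto
    then show False using E assms(3,4) by simp
  qed
  have "2 * L \<le> (5 + 2 * a * t + (2 * a + 3)) * k"
    using assms by (intro order.trans[OF assms(5)] mult_right_mono) (auto simp: E)
  then have "2 - 2 * t \<le> 2 * (a * k * t)" by (simp add: t_def algebra_simps)
  moreover have "a * k * t \<le> 0"
    using \<open>t \<le> 0\<close> assms by (intro mult_nonneg_nonpos) auto
  ultimately show False using \<open>t \<le> 0\<close> by linarith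
qed

text \<open>So few terms give a sum of absolute value below 2n, so only the multiples 0, n and -n
  are possible, and the last two are ruled out by
  \<open>progression_sum_neq_modulus\<close>.\<close>

lemma sum_signed_progression_eq_0:
  assumes "\<alpha> \<ge> 1" "k \<ge> 1" and n: "n = 2 * \<alpha> * (\<alpha> + 4) * k + 2 * \<alpha> + 5"
    and A: "finite A" "card A \<le> 2 * \<alpha> + 3" "\<And>i. i \<in> A \<Longrightarrow> t i \<in> signed_progression \<alpha> k"
    and "int n dvd sum t A"
  shows "sum t A = 0"
proof -
  define a K M where "a = int \<alpha>" and "K = int k" and "M = int (card A)"
  have ak: "a \<ge> 1" "K \<ge> 1" "M \<le> 2 * a + 3" "M \<ge> 0"
    using assms by (auto simp: a_def K_def M_def)
  have n': "int n = 2 * a * (a + 4) * K + 2 * a + 5"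
    by (simp add: n a_def K_def algebra_simps)
  obtain L E where LE: "sum t A = 2 * a * L + E" "\<bar>E\<bar> \<le> M"
    "2 * L \<le> (E + M) * K" "(E - M) * K \<le> 2 * L"
    using sum_signed_progression[where t = t, OF A(1,3)] unfolding a_def K_def M_def by blast
  from \<open>int n dvd sum t A\<close> obtain c where c: "2 * a * L + E = int n * c"
    unfolding LE(1) by blast
  have EM: "E \<le> M" "- E \<le> M" using LE(2) by linarith+
  \<comment> \<open>As |E| \<le> M \<le> 2a + 3, both E + M and E - M have absolute value at most
    2(2a + 3), which yields |L| \<le> (2a + 3)K.\<close>
  have "(E + M) * K \<le> (2 * (2 * a + 3)) * K" "(- (2 * (2 * a + 3))) * K \<le> (E - M) * K"
    using LE(2) ak by (auto intro!: mult_right_mono)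
  then have "\<bar>L\<bar> \<le> (2 * a + 3) * K"
    using LE(3,4) by (simp add: algebra_simps)
  then have "a * \<bar>L\<bar> \<le> a * ((2 * a + 3) * K)"
    using ak by (intro mult_left_mono) auto
  then have "\<bar>a * L\<bar> \<le> a * ((2 * a + 3) * K)" using ak by (simp add: abs_mult)
  moreover have "2 * a * L = 2 * (a * L)" by simp
  ultimately have "\<bar>2 * a * L + E\<bar> \<le> 2 * (a * ((2 * a + 3) * K)) + (2 * a + 3)"
    using LE(2) ak(3) by linarith
  moreover have "2 * int n = 2 * (a * ((2 * a + 3) * K)) + (2 * a + 3) + (10 * (a * K) + 2 * a + 7)"
    unfolding n' by (simp add: algebra_simps)
  moreover have "a * K \<ge> 0" using ak by simp
  ultimately have "\<bar>2 * a * L + E\<bar> < 2 * int n" using ak(1) by linarith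
  then have "int n * \<bar>c\<bar> < int n * 2"
    unfolding c by (simp add: abs_mult)
  then have "\<bar>c\<bar> < 2" by (subst (asm) mult_less_cancel_left) auto
  then consider "c = 0" | "c = 1" | "c = -1" by linarith
  then show ?thesis
  proof cases
    case 1
    then show ?thesis using LE c by simp
  next
    case 2
    then show ?thesis
      using progression_sum_neq_modulus[of a K E M L] EM LE c ak n' 2 by simp
  next
    case 3
    \<comment> \<open>Negating all terms replaces (L, E) by (-L, -E), so the lower bound on L
      becomes the upper bound required.\<close>
    have "2 * (-L) \<le> (-E + M) * K" using LE(4) by (simp add: algebra_simps)
    then show ?thesis
      using progression_sum_neq_modulus[of a K "-E" M "-L"] EM c ak n' 3 by simp
  qed
qed

text \<open>An odd number of odd integers has an odd sum, which cannot be the integer 0.\<close>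

lemma odd_sum_not_dvd:
  assumes "\<alpha> \<ge> 1" "k \<ge> 1" "n = 2 * \<alpha> * (\<alpha> + 4) * k + 2 * \<alpha> + 5"
    and "finite A" "card A \<le> 2 * \<alpha> + 3" "\<And>i. i \<in> A \<Longrightarrow> t i \<in> signed_progression \<alpha> k"
    and "odd (card A)"
  shows "\<not> int n dvd sum t A"
  using sum_signed_progression_eq_0[OF assms(1-6)] even_sum_signed_progression[OF assms(4,6)] assms(7)
  by fastforce

section \<open>Sequences without vanishing blocks\<close>

text \<open>Greedy filling from the last position: it takes as much of L as the cap k allows, and
  the rest fits into the earlier positions. The value of \<open>f p\<close> is recorded because a
  positive last summand is what later prevents cancellation.\<close>

lemma bounded_summands:
  assumes "L \<le> p * k" "p \<ge> 1"
  obtains f :: "nat \<Rightarrow> nat" where "\<And>i. f i \<le> k" "sum f {1..p} = L" "f p = min L k"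
proof -
  have "\<exists>f. (\<forall>i. f i \<le> k) \<and> sum f {1..p} = L \<and> f p = min L k"
    using assms(2,1)
  proof (induction p arbitrary: L rule: dec_induct)
    case base
    then show ?case by (intro exI[of _ "\<lambda>_. L"]) auto
  next
    case (step p)
    have "L - min L k \<le> p * k" using step.prems by auto
    then obtain f where f: "\<forall>i. f i \<le> k" "sum f {1..p} = L - min L k"
      using step.IH by blast
    have "sum (f(Suc p := min L k)) {1..p} = sum f {1..p}"
      by (rule sum.cong) auto
    with f show ?case
      by (intro exI[of _ "f(Suc p := min L k)"]) auto
  qed
  then show ?thesis using that by blast
qed

text \<open>Placing all positive terms before all negative ones confines possible cancellation to
  blocks that straddle position \<open>p\<close>.\<close>

definition up_down :: "nat \<Rightarrow> nat \<Rightarrow> (nat \<Rightarrow> nat) \<Rightarrow> nat \<Rightarrow> int" where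
  "up_down \<alpha> p h i =
     (if i \<le> p then 2 * int \<alpha> * int (h i) + 1 else - (2 * int \<alpha> * int (h i)) - 1)"

lemma up_down_in_signed_progression: "h i \<le> k \<Longrightarrow> up_down \<alpha> p h i \<in> signed_progression \<alpha> k"
  by (simp add: up_down_def pos_in_signed_progression neg_in_signed_progression)

lemma sum_up_down_le:
  assumes "j \<le> p"
  shows "sum (up_down \<alpha> p h) {i..j} = 2 * int \<alpha> * int (sum h {i..j}) + int (Suc j - i)"
proof -
  have "sum (up_down \<alpha> p h) {i..j} = (\<Sum>x\<in>{i..j}. 2 * int \<alpha> * int (h x) + 1)"
    using assms by (intro sum.cong) (auto simp: up_down_def)
  then show ?thesis by (simp add: sum.distrib sum_distrib_left)
qed

lemma sum_up_down_gt:
  assumes "p < i"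
  shows "sum (up_down \<alpha> p h) {i..j} = - (2 * int \<alpha> * int (sum h {i..j})) - int (Suc j - i)"
proof -
  have "sum (up_down \<alpha> p h) {i..j} = (\<Sum>x\<in>{i..j}. - (2 * int \<alpha> * int (h x)) - 1)"
    using assms by (intro sum.cong) (auto simp: up_down_def)
  then show ?thesis by (simp add: sum_subtractf sum_negf sum_distrib_left)
qed

lemma sum_up_down_split:
  assumes "i \<le> p" "p < j"
  shows "sum (up_down \<alpha> p h) {i..j} = 2 * int \<alpha> * int (sum h {i..p}) + int (Suc p - i)
    - 2 * int \<alpha> * int (sum h {Suc p..j}) - int (j - p)"
proof -
  have "{i..j} = {i..p} \<union> {Suc p..j}" using assms by auto
  then have "sum (up_down \<alpha> p h) {i..j}
      = sum (up_down \<alpha> p h) {i..p} + sum (up_down \<alpha> p h) {Suc p..j}"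
    by (simp add: sum.union_disjoint)
  then show ?thesis by (simp add: sum_up_down_le sum_up_down_gt)
qed

text \<open>A block on one side of \<open>p\<close> has terms of a single sign. For a straddling
  block the hypothesis compares its positive part with the absolute value of its negative
  part.\<close>

lemma sum_up_down_nonzero:
  assumes "i \<le> j"
    and "i \<le> p \<Longrightarrow> p < j \<Longrightarrow> 2 * int \<alpha> * int (sum h {i..p}) + int (Suc p - i)
      \<noteq> 2 * int \<alpha> * int (sum h {Suc p..j}) + int (j - p)"
  shows "sum (up_down \<alpha> p h) {i..j} \<noteq> 0"
proof -
  consider "j \<le> p" | "p < i" | "i \<le> p" "p < j" by linarith
  then show ?thesis
  proof cases
    case 1
    have "2 * int \<alpha> * int (sum h {i..j}) \<ge> 0" by (intro mult_nonneg_nonneg) (simp_all del: of_nat_sum)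
    then show ?thesis using sum_up_down_le[OF 1, of \<alpha> h i] assms(1) by linarith
  next
    case 2
    have "2 * int \<alpha> * int (sum h {i..j}) \<ge> 0" by (intro mult_nonneg_nonneg) (simp_all del: of_nat_sum)
    then show ?thesis using sum_up_down_gt[OF 2, of \<alpha> h j] assms(1) by linarith
  next
    case 3
    then show ?thesis using sum_up_down_split[OF 3, of \<alpha> h] assms(2) by linarith
  qed
qed

lemma up_down_exists:
  assumes "\<alpha> \<ge> 1" "k \<ge> 1" "1 \<le> e" "e \<le> \<alpha> + 1" "L \<le> (\<alpha> + 1 + e) * k"
  obtains t where "\<And>i. i \<in> {1..2 * \<alpha> + 2} \<Longrightarrow> t i \<in> signed_progression \<alpha> k"
    "sum t {1..2 * \<alpha> + 2} = 2 * (int \<alpha> * int L + int e)"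
    "\<And>i j. 1 \<le> i \<Longrightarrow> i < j \<Longrightarrow> j \<le> 2 * \<alpha> + 2 \<Longrightarrow> sum t {i..j} \<noteq> 0"
proof -
  note witness = that
  define p where "p = \<alpha> + 1 + e"
  have p: "1 \<le> p" "p \<le> 2 * \<alpha> + 2" "e + \<alpha> + 1 = p" using assms by (auto simp: p_def)
  \<comment> \<open>It remains to choose the indices \<open>h\<close>. Their net sum must be L,
    because the constants +1 and -1 of the \<open>p\<close> positive and 2\<alpha> + 2 - p negative
    terms already contribute 2e.\<close>
  have *: thesis
    if h: "\<And>i. h i \<le> k"
      and L: "int (sum h {1..p}) = int (sum h {Suc p..2 * \<alpha> + 2}) + int L"
      and nz: "\<And>i j. 1 \<le> i \<Longrightarrow> i \<le> p \<Longrightarrow> p < j \<Longrightarrow> j \<le> 2 * \<alpha> + 2 \<Longrightarrow>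
        2 * int \<alpha> * int (sum h {i..p}) + int (Suc p - i)
          \<noteq> 2 * int \<alpha> * int (sum h {Suc p..j}) + int (j - p)" for h
  proof (rule witness[of "up_down \<alpha> p h"])
    show "sum (up_down \<alpha> p h) {1..2 * \<alpha> + 2} = 2 * (int \<alpha> * int L + int e)"
    proof (cases "p < 2 * \<alpha> + 2")
      case True
      show ?thesis
        unfolding sum_up_down_split[OF p(1) True] L
        using p by (simp add: algebra_simps of_nat_diff)
    next
      case False
      then have p_eq: "p = 2 * \<alpha> + 2" and e_eq: "e = \<alpha> + 1" using p by auto
      have sum_h: "int (sum h {1..2 * \<alpha> + 2}) = int L"
        using L unfolding p_eq by simp
      show ?thesis
        unfolding sum_up_down_le[OF eq_refl[OF p_eq[symmetric]]] sum_h
        using e_eq by (simp add: algebra_simps)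
    qed
    show "sum (up_down \<alpha> p h) {i..j} \<noteq> 0" if "1 \<le> i" "i < j" "j \<le> 2 * \<alpha> + 2" for i j
      by (rule sum_up_down_nonzero) (use nz that in auto)
  qed (simp add: up_down_in_signed_progression h)
  show thesis
  proof (cases "L = 0 \<and> e \<le> \<alpha>")
    case True
    \<comment> \<open>Taking all terms \<plusminus>1 would cancel at positions \<open>p\<close>,
      \<open>Suc p\<close>. With this \<open>h\<close>, a straddling block always contains the term
      -(2\<alpha>+1). If it starts at 1, the two large terms cancel and p > \<alpha> + 1 - e leaves
      a positive rest; otherwise its positive part is at most p - 1 = \<alpha> + e \<le> 2\<alpha>,
      which is too small.\<close>
    define h where "h = (\<lambda>i. if i = 1 \<or> i = Suc p then 1 else 0 :: nat)"
    have h1: "sum h {i..p} = (if i = 1 then 1 else 0)" if "1 \<le> i" for i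
      using that p by (auto simp: h_def sum.If_cases)
    have h2: "sum h {Suc p..j} = 1" if "p < j" for j
      using that p by (auto simp: h_def sum.If_cases)
    show ?thesis
    proof (rule *[of h])
      show "h i \<le> k" for i using assms by (simp add: h_def)
      show "int (sum h {1..p}) = int (sum h {Suc p..2 * \<alpha> + 2}) + int L"
        using True p h1[of 1] h2[of "2 * \<alpha> + 2"] by simp
      show "2 * int \<alpha> * int (sum h {i..p}) + int (Suc p - i)
          \<noteq> 2 * int \<alpha> * int (sum h {Suc p..j}) + int (j - p)"
        if "1 \<le> i" "i \<le> p" "p < j" "j \<le> 2 * \<alpha> + 2" for i j
        using h1[OF that(1)] h2[OF that(3)] that True assms(3) unfolding p_def by auto
    qed
  next
    case False
    obtain f where f: "\<And>i. f i \<le> k" "sum f {1..p} = L" "f p = min L k"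
      using bounded_summands[of L p k] assms p p_def by metis
    define h where "h = (\<lambda>i. if i \<le> p then f i else 0)"
    have h1: "sum h {i..p} = sum f {i..p}" for i
      unfolding h_def by (intro sum.cong) auto
    have h2: "sum h {Suc p..j} = 0" for j
      by (auto simp: h_def)
    show ?thesis
    proof (rule *[of h])
      show "h i \<le> k" for i using f by (simp add: h_def)
      show "int (sum h {1..p}) = int (sum h {Suc p..2 * \<alpha> + 2}) + int L"
        unfolding h1 h2 f(2) by simp
      show "2 * int \<alpha> * int (sum h {i..p}) + int (Suc p - i)
          \<noteq> 2 * int \<alpha> * int (sum h {Suc p..j}) + int (j - p)"
        if "1 \<le> i" "i \<le> p" "p < j" "j \<le> 2 * \<alpha> + 2" for i j
      proof -
        \<comment> \<open>A straddling block needs a negative term, hence e \<le> \<alpha> and L >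
          0. The block contains position \<open>p\<close>, whose term is at least 2\<alpha> + 1,
          against at most \<alpha> terms -1.\<close>
        have "e \<le> \<alpha>" using that p by linarith
        then have "1 \<le> f p" using False f(3) assms by simp
        also have "f p \<le> sum f {i..p}"
          using that by (intro member_le_sum) auto
        finally have "2 * int \<alpha> * (1::int) \<le> 2 * int \<alpha> * int (sum f {i..p})"
          by (intro mult_left_mono) (auto simp del: of_nat_sum)
        moreover have "int (j - p) \<le> int \<alpha>" using that assms(3) p by linarith
        ultimately show ?thesis using assms(1) unfolding h1 h2 by linarith
      qed
    qed
  qed
qed

section \<open>Writing half of an even representative as \<alpha>L + e\<close>

text \<open>The size of \<open>y\<close> alone gives the bound on L when e \<ge> 3. It can fail only
  for e = 2, and then 2y is congruent to some -(2\<alpha>l + 1) with l \<le> k, which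
  \<open>notin\<close> forbids.\<close>

lemma coefficients_exist:
  fixes \<alpha> k n y :: nat
  assumes "\<alpha> \<ge> 1" "k \<ge> 1" and n: "n = 2 * \<alpha> * (\<alpha> + 4) * k + 2 * \<alpha> + 5"
    and y: "1 \<le> y" "2 * y < n"
    and notin: "\<And>l. l \<le> k \<Longrightarrow> 2 * y + (2 * \<alpha> * l + 1) \<noteq> n"
  obtains e L where "1 \<le> e" "e \<le> \<alpha> + 1" "L \<le> (\<alpha> + 1 + e) * k" "y = \<alpha> * L + e"
proof (cases "y = 1")
  case True
  then show ?thesis using that[of 1 0] assms by simp
next
  case False
  \<comment> \<open>Dividing y - 2 instead of y puts e between 2 and \<alpha> + 1, away from the
    small values for which fewer positive terms are available.\<close>
  define L e where "L = (y - 2) div \<alpha>" and "e = 2 + (y - 2) mod \<alpha>"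
  have yeq: "y = \<alpha> * L + e" using y False by (simp add: L_def e_def)
  have "(y - 2) mod \<alpha> < \<alpha>" using assms by simp
  then have e: "2 \<le> e" "e \<le> \<alpha> + 1" unfolding e_def by linarith+
  \<comment> \<open>As n is odd, 2y < n means 2y \<le> n - 1.\<close>
  have ub: "\<alpha> * L + e \<le> \<alpha> * ((\<alpha> + 4) * k) + \<alpha> + 2"
    using y(2) unfolding n yeq by (simp add: algebra_simps)
  have "L \<le> (\<alpha> + 1 + e) * k"
  proof (cases "e = 2")
    case True
    show ?thesis
    proof (rule ccontr)
      assume "\<not> ?thesis"
      then have lb: "(\<alpha> + 3) * k < L" using True by (simp add: algebra_simps)
      have "\<alpha> * L \<le> \<alpha> * ((\<alpha> + 4) * k + 1)" using ub True by simp
      then have L: "L \<le> (\<alpha> + 4) * k + 1" using assms(1) unfolding mult_le_cancel1 by linarith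
      \<comment> \<open>This is the index for which 2y = n - (2\<alpha>l + 1); the assumed failure L
        > (\<alpha>+3)k is exactly what makes l \<le> k.\<close>
      define l where "l = (\<alpha> + 4) * k + 1 - L"
      have l: "l + L = (\<alpha> + 4) * k + 1" using L by (simp add: l_def)
      then have "l \<le> k" using lb by (simp add: algebra_simps)
      have "2 * y + (2 * \<alpha> * l + 1) = 2 * \<alpha> * (l + L) + 5"
        by (simp add: yeq True algebra_simps)
      also have "\<dots> = n" unfolding l n by (simp add: algebra_simps)
      finally show False using notin \<open>l \<le> k\<close> by blast
    qed
  next
    case False
    then have "\<alpha> * L < \<alpha> * ((\<alpha> + 4) * k + 1)" using ub e by simp
    then have "L < (\<alpha> + 4) * k + 1" unfolding mult_less_cancel1 by blast
    then have "L \<le> (\<alpha> + 4) * k" by simp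
    also have "\<dots> \<le> (\<alpha> + 1 + e) * k" using False e by (intro mult_right_mono) auto
    finally show ?thesis .
  qed
  then show ?thesis using that[of e L] e yeq by simp
qed

theorem theorem1p4:
  fixes \<alpha> k n :: nat and S :: "int set"
  assumes "\<alpha> \<ge> 1" and "k \<ge> 1"
    and "n = 2 * \<alpha> * (\<alpha> + 4) * k + 2 * \<alpha> + 5"
    and "S = pm_progression n \<alpha> k"
  shows "restricted_sums (integer_mod_group n) (2 * \<alpha> + 2) S
           = carrier (integer_mod_group n) - (S \<union> {0})
         \<and> 0 \<notin> sumset_fold (integer_mod_group n) (2 * \<alpha> + 3) S"
proof (intro conjI equalityI subsetI)
  let ?T = "signed_progression \<alpha> k" and ?m = "2 * \<alpha> + 2"
  have npos: "n > 0" and nodd: "odd n" using assms by auto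
  have S: "S = (\<lambda>z. z mod int n) ` ?T" by (simp add: assms(4) pm_progression_eq_image)
  note RS = restricted_sums_integer_mod_group[OF npos, of _ ?T, folded S]
  show "0 \<notin> sumset_fold (integer_mod_group n) (2 * \<alpha> + 3) S"
    unfolding S sumset_fold_integer_mod_group[OF npos]
    using odd_sum_not_dvd[OF assms(1-3), of "{1..2 * \<alpha> + 3}"]
    by (force simp: dvd_eq_mod_eq_0)
  fix x
  {
    assume "x \<in> restricted_sums (integer_mod_group n) ?m S"
    then obtain t where x: "x = sum t {1..?m} mod int n" and t: "\<forall>i\<in>{1..?m}. t i \<in> ?T"
      and w: "\<forall>i j. 1 \<le> i \<and> i < j \<and> j \<le> ?m \<longrightarrow> \<not> int n dvd sum t {i..j}"
      unfolding RS by blast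
    have "x \<noteq> 0" using w[rule_format, of 1 ?m] by (auto simp: x dvd_eq_mod_eq_0)
    moreover have "x \<notin> S"
    proof
      assume "x \<in> S"
      then obtain z where z: "z \<in> ?T" "x = z mod int n" unfolding S by blast
      \<comment> \<open>Appending -z would give 2\<alpha> + 3 terms, an odd number, with sum
        divisible by \<open>n\<close>.\<close>
      define u where "u = t(Suc ?m := - z)"
      have "u i \<in> ?T" if "i \<in> {1..Suc ?m}" for i
        using that t uminus_signed_progression[OF z(1)] by (auto simp: u_def)
      then have "\<not> int n dvd sum u {1..Suc ?m}"
        using odd_sum_not_dvd[OF assms(1-3), of "{1..Suc ?m}" u] by simp
      moreover have "sum u {1..?m} = sum t {1..?m}"
        unfolding u_def by (rule sum.cong) auto
      then have "sum u {1..Suc ?m} = sum t {1..?m} - z" by (simp add: u_def)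
      ultimately show False using x z(2) by (metis mod_eq_dvd_iff)
    qed
    ultimately show "x \<in> carrier (integer_mod_group n) - (S \<union> {0})"
      using npos by (auto simp: x carrier_integer_mod_group)
  }
  assume "x \<in> carrier (integer_mod_group n) - (S \<union> {0})"
  then have x: "0 < x" "x < int n" "x \<notin> S"
    using npos by (auto simp: carrier_integer_mod_group)
  \<comment> \<open>A sum of 2\<alpha> + 2 odd terms is even, so \<open>x\<close> is replaced by its
    even representative strictly between -n and n; it exists because n is odd.\<close>
  define z where "z = (if even x then x else x - int n)"
  have z: "even z" "z \<noteq> 0" "\<bar>z\<bar> < int n" "z mod int n = x"
    using x nodd by (auto simp: z_def)
  define y where "y = nat \<bar>z\<bar> div 2"
  have zy: "\<bar>z\<bar> = 2 * int y" using z(1) by (auto elim!: evenE simp: y_def abs_mult nat_mult_distrib)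
  have y: "1 \<le> y" "2 * y < n" using z zy by linarith+
  have "z = 1 * (2 * int y) \<or> z = -1 * (2 * int y)" using zy by linarith
  then obtain \<epsilon> :: int where \<epsilon>: "\<epsilon> = 1 \<or> \<epsilon> = -1" "z = \<epsilon> * (2 * int y)"
    by blast
  have scale: "v \<in> ?T \<Longrightarrow> \<epsilon> * v \<in> ?T" for v
    using \<epsilon>(1) uminus_signed_progression by auto
  have notin: "2 * y + (2 * \<alpha> * l + 1) \<noteq> n" if "l \<le> k" for l
  proof
    assume *: "2 * y + (2 * \<alpha> * l + 1) = n"
    \<comment> \<open>Substituting 2y = n - (2\<alpha>l + 1) into z = \<epsilon> 2y exhibits
      \<open>x\<close> as the residue of a member of the progression, contrary to x not lying in
      S.\<close>
    have "z = \<epsilon> * (- (2 * int \<alpha> * int l) - 1) + \<epsilon> * int n"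
      unfolding \<epsilon>(2) *[symmetric] by (simp add: algebra_simps)
    then have "x = (\<epsilon> * (- (2 * int \<alpha> * int l) - 1)) mod int n"
      using z(4) by simp
    then show False
      using x(3) scale[OF neg_in_signed_progression[OF that]] unfolding S by blast
  qed
  obtain e L where eL: "1 \<le> e" "e \<le> \<alpha> + 1" "L \<le> (\<alpha> + 1 + e) * k" "y = \<alpha> * L + e"
    using coefficients_exist[OF assms(1-3) y notin] by blast
  obtain t where t: "\<And>i. i \<in> {1..?m} \<Longrightarrow> t i \<in> ?T"
    "sum t {1..?m} = 2 * (int \<alpha> * int L + int e)"
    "\<And>i j. 1 \<le> i \<Longrightarrow> i < j \<Longrightarrow> j \<le> ?m \<Longrightarrow> sum t {i..j} \<noteq> 0"
    using up_down_exists[OF assms(1,2) eL(1-3)] by blast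
  define u where "u i = \<epsilon> * t i" for i
  have u: "u i \<in> ?T" if "i \<in> {1..?m}" for i
    using t(1)[OF that] scale by (simp add: u_def)
  have sum_u: "sum u A = \<epsilon> * sum t A" for A by (simp add: u_def sum_distrib_left)
  have "\<not> int n dvd sum u {i..j}" if "1 \<le> i" "i < j" "j \<le> ?m" for i j
  proof
    assume "int n dvd sum u {i..j}"
    \<comment> \<open>A block has at most 2\<alpha> + 2 terms, so divisibility by \<open>n\<close>
      forces its integer sum to be 0, which the construction of \<open>t\<close> excludes.\<close>
    then have "sum u {i..j} = 0"
      using that u by (intro sum_signed_progression_eq_0[OF assms(1-3)]) auto
    then show False using t(3)[OF that] \<epsilon>(1) by (auto simp: sum_u)
  qed
  moreover have "x = sum u {1..?m} mod int n"
    using z(4) unfolding \<epsilon>(2) sum_u t(2) eL(4) by simp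
  ultimately show "x \<in> restricted_sums (integer_mod_group n) ?m S"
    unfolding RS using u by blast
qed

end
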